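(* Let $A$ be a left brace whose multiplicative group $(A,\circ)$ is isomorphic to $\mathbb{Z}$. Then $A$ is a trivial brace, i.e. $a\circ b=a+b$ for all $a,b\in A$; in particular the additive group of $A$ is isomorphic to $\mathbb{Z}$.
   Context: A skew left brace is a triple $(A,+,\circ)$ where $(A,+)$ and $(A,\circ)$ are (not necessarily abelian) groups such that $a\circ(b+c)=a\circ b-a+a\circ c$ for all $a,b,c\in A$. $(A,+)$ is called the additive group and $(A,\circ)$ the multiplicative group. A left brace is a skew left brace whose additive group is abelian. *)

theory Defs
  imports "HOL-Algebra.Ring" "HOL-Algebra.Elementary_Groups"
begin

text \<open>
  A skew left brace lives on the record type of rings, whose fields are exactly the data needed:
  \<open>\<oplus>\<close> and \<open>\<zero>\<close> are the additive group structure, while \<open>\<otimes>\<close> and \<open>\<one>\<close> are the operation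
  \<open>\<circ>\<close> and its neutral element. No ring axiom is assumed. Accordingly \<open>add_monoid A\<close> is the
  additive group of the brace, and \<open>A\<close> itself, seen as a monoid record, is its multiplicative group.
  The additive group need not be abelian, so the order of the summands in the brace law matters.
\<close>

locale skew_left_brace =
  fixes A :: "('a, 'm) ring_scheme" (structure)
  assumes additive_group: "group (add_monoid A)"
    and multiplicative_group: "group A"
    and brace_law:
      "\<lbrakk>a \<in> carrier A; b \<in> carrier A; c \<in> carrier A\<rbrakk>
        \<Longrightarrow> a \<otimes> (b \<oplus> c) = ((a \<otimes> b) \<ominus> a) \<oplus> (a \<otimes> c)"

locale left_brace = skew_left_brace +
  assumes additive_comm_group: "comm_group (add_monoid A)"

end

theory Submission
  imports Defs "HOL-Computational_Algebra.Polynomial"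
begin

text \<open>
  Let \<open>g\<close> generate the multiplicative group and let \<open>T\<close> be the automorphism \<open>b \<mapsto> - g + g \<circ> b\<close> of the
  additive group. The cocycle identity gives \<open>g\<^sup>n = g + T g + \<dots> + T\<^bsup>n - 1\<^esup> g\<close>, so the additive group is
  a quotient \<open>R\<close> of \<open>\<int>[t, 1/t]\<close> in which every element is uniquely of the form
  \<open>(t\<^sup>n - 1)/(t - 1)\<close>, that is, \<open>1 + t + \<dots> + t\<^bsup>n - 1\<^esup>\<close> or minus such a sum divided by \<open>t\<^sup>n\<close>. In particular
  every element of \<open>1 + (t - 1)R\<close> is a power of \<open>t\<close>.

  Suppose \<open>t \<noteq> 1\<close>. Writing \<open>t - 1\<close> in this form and reducing modulo \<open>t - 1\<close> shows that some integer
  \<open>d > 0\<close> lies in \<open>(t - 1)R\<close>. Then \<open>1 + d\<close> and \<open>1 + 2d\<close> are powers of \<open>t\<close>, so they are multiplicatively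
  dependent in \<open>R\<close> although they are coprime integers; hence \<open>R\<close> has characteristic \<open>N > 0\<close>. Writing \<open>t\<close>
  itself in the above form yields a monic equation for \<open>t\<close>, so the powers of \<open>t\<close> form a finite set
  and \<open>t\<^sup>r = 1\<close> for some \<open>r > 0\<close>. Now \<open>1 + t + \<dots> + t\<^bsup>r N - 1\<^esup> = N (1 + t + \<dots> + t\<^bsup>r - 1\<^esup>) = 0\<close>
  contradicts uniqueness.
\<close>

lemma coprime_powers_neq:
  fixes P Q :: nat
  assumes "coprime P Q" "P > 1" "0 < b"
  shows "P ^ b \<noteq> Q ^ a"
proof
  assume eq: "P ^ b = Q ^ a"
  have "coprime (P ^ b) (Q ^ a)"
    using assms(1) by simp
  then have "P ^ b = 1"
    using eq by simp
  then show False
    using assms by simp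
qed

text \<open>The assumptions on \<open>I\<close> say that \<open>t\<close> acts injectively on the quotient by \<open>I\<close>, and that the
  geometric sums of positive and, after clearing powers of \<open>t\<close>, of negative length exhaust it.\<close>

locale geometric_ideal =
  fixes I :: "'r::comm_ring_1 set" and t :: 'r
  assumes zero_mem: "0 \<in> I"
    and add_mem: "\<lbrakk>p \<in> I; q \<in> I\<rbrakk> \<Longrightarrow> p + q \<in> I"
    and mult_mem: "p \<in> I \<Longrightarrow> r * p \<in> I"
    and cancel: "t * p \<in> I \<Longrightarrow> p \<in> I"
    and geometric_rep: "\<exists>n. p - (\<Sum>i<n. t ^ i) \<in> I \<or> t ^ n * p + (\<Sum>i<n. t ^ i) \<in> I"
    and geometric_nonzero: "0 < n \<Longrightarrow> (\<Sum>i<n. t ^ i) \<notin> I"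
begin

section \<open>Congruence modulo the ideal and geometric sums\<close>

definition eqv :: "'r \<Rightarrow> 'r \<Rightarrow> bool" (infix "\<approx>" 50)
  where "p \<approx> q \<longleftrightarrow> p - q \<in> I"

lemma uminus_mem: "p \<in> I \<Longrightarrow> - p \<in> I"
  using mult_mem[of p "- 1"] by simp

lemma eqv_refl: "p \<approx> p"
  by (simp add: eqv_def zero_mem)

lemma eqv_sym: "p \<approx> q \<Longrightarrow> q \<approx> p"
  using uminus_mem[of "p - q"] by (simp add: eqv_def)

lemma eqv_trans [trans]: "\<lbrakk>p \<approx> q; q \<approx> r\<rbrakk> \<Longrightarrow> p \<approx> r"
  using add_mem[of "p - q" "q - r"] by (simp add: eqv_def)

lemma eqv_add: "\<lbrakk>p \<approx> q; p' \<approx> q'\<rbrakk> \<Longrightarrow> p + p' \<approx> q + q'"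
  using add_mem[of "p - q" "p' - q'"] by (simp add: eqv_def algebra_simps)

lemma eqv_mult:
  assumes "p \<approx> q" "p' \<approx> q'"
  shows "p * p' \<approx> q * q'"
proof -
  have "p * p' - q * q' = p' * (p - q) + q * (p' - q')"
    by (simp add: algebra_simps)
  then show ?thesis
    using assms by (auto simp: eqv_def intro: add_mem mult_mem)
qed

lemma eqv_power: "p \<approx> q \<Longrightarrow> p ^ n \<approx> q ^ n"
  by (induction n) (auto intro: eqv_refl eqv_mult)

lemma eqv_sum: "(\<And>i. i \<in> S \<Longrightarrow> f i \<approx> g i) \<Longrightarrow> sum f S \<approx> sum g S"
  by (induction S rule: infinite_finite_induct) (auto intro: eqv_refl eqv_add)

lemma cancel_power: "t ^ n * p \<in> I \<Longrightarrow> p \<in> I"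
  by (induction n) (auto simp: mult.assoc dest: cancel)

lemma eqv_cancel_power: "t ^ n * p \<approx> t ^ n * q \<Longrightarrow> p \<approx> q"
  using cancel_power[of n "p - q"] by (simp add: eqv_def algebra_simps)

lemma one_notin: "1 \<notin> I"
  using geometric_nonzero[of 1] by simp

lemma geometric_sum: "(t - 1) * (\<Sum>i<n. t ^ i) = t ^ n - 1"
  by (simp add: power_diff_1_eq)

text \<open>Multiplying the representation of \<open>p\<close> by \<open>t - 1\<close> telescopes
  the geometric sum. The second alternative stands for a negative power of \<open>t\<close>, which
  need not exist in the ring itself.\<close>

lemma one_plus_multiple:
  "\<exists>n. 1 + (t - 1) * p \<approx> t ^ n \<or> t ^ n * (1 + (t - 1) * p) \<approx> 1"
proof -
  obtain n where "p - (\<Sum>i<n. t ^ i) \<in> I \<or> t ^ n * p + (\<Sum>i<n. t ^ i) \<in> I"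
    using geometric_rep by blast
  then have "(t - 1) * (p - (\<Sum>i<n. t ^ i)) \<in> I \<or> (t - 1) * (t ^ n * p + (\<Sum>i<n. t ^ i)) \<in> I"
    using mult_mem by blast
  moreover have "(t - 1) * (p - (\<Sum>i<n. t ^ i)) = 1 + (t - 1) * p - t ^ n"
    by (simp only: right_diff_distrib[of "t - 1"] geometric_sum) simp
  moreover have "(t - 1) * (t ^ n * p + (\<Sum>i<n. t ^ i)) = t ^ n * (1 + (t - 1) * p) - 1"
    by (simp only: distrib_left[of "t - 1"] geometric_sum) (simp add: algebra_simps)
  ultimately show ?thesis
    unfolding eqv_def by metis
qed

text \<open>Each power of \<open>t\<close> is 1 modulo \<open>t - 1\<close>, so only the number of
  terms survives.\<close>

lemma geometric_sum_minus_of_nat: "\<exists>g. (\<Sum>i<n. t ^ i) = of_nat n + (t - 1) * g"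
proof (induction n)
  case (Suc n)
  then obtain g where "(\<Sum>i<n. t ^ i) = of_nat n + (t - 1) * g"
    by blast
  moreover have "t ^ n = 1 + (t - 1) * (\<Sum>i<n. t ^ i)"
    by (simp add: geometric_sum)
  ultimately have "(\<Sum>i<Suc n. t ^ i) = of_nat (Suc n) + (t - 1) * (g + (\<Sum>i<n. t ^ i))"
    by (simp add: distrib_left)
  then show ?case
    by blast
qed (auto intro: exI[of _ 0])

lemma of_nat_multiple:
  assumes "t - 1 \<notin> I"
  obtains d :: nat and f where "0 < d" "of_nat d \<approx> (t - 1) * f"
proof -
  obtain n where n: "(t - 1) - (\<Sum>i<n. t ^ i) \<in> I \<or> t ^ n * (t - 1) + (\<Sum>i<n. t ^ i) \<in> I"
    using geometric_rep by blast
  \<comment> \<open>For \<open>n = 0\<close> both alternatives would say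
    \<open>t - 1 \<in> I\<close>.\<close>
  then have "0 < n"
    using assms by (cases n) auto
  obtain g where g: "(\<Sum>i<n. t ^ i) = of_nat n + (t - 1) * g"
    using geometric_sum_minus_of_nat by blast
  from n show thesis
  proof
    assume "(t - 1) - (\<Sum>i<n. t ^ i) \<in> I"
    moreover have "(t - 1) - (\<Sum>i<n. t ^ i) = (t - 1) * (1 - g) - of_nat n"
      by (simp add: g algebra_simps)
    ultimately show thesis
      using that \<open>0 < n\<close> eqv_sym unfolding eqv_def by metis
  next
    assume "t ^ n * (t - 1) + (\<Sum>i<n. t ^ i) \<in> I"
    moreover have "t ^ n * (t - 1) + (\<Sum>i<n. t ^ i) = of_nat n - (t - 1) * (- g - t ^ n)"
      by (simp add: g algebra_simps)
    ultimately show thesis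
      using that \<open>0 < n\<close> unfolding eqv_def by metis
  qed
qed

section \<open>Positive characteristic of the quotient\<close>

lemma of_nat_eqv_imp_char:
  assumes "of_nat m \<approx> of_nat n" "m \<noteq> n"
  obtains N :: nat where "0 < N" "of_nat N \<in> I"
proof (cases "m < n")
  case True
  then have "of_nat (n - m) = (of_nat n - of_nat m :: 'r)"
    by (simp add: of_nat_diff)
  then show ?thesis
    using that[of "n - m"] True eqv_sym[OF assms(1)] by (simp add: eqv_def)
next
  case False
  then have "of_nat (m - n) = (of_nat m - of_nat n :: 'r)"
    by (simp add: of_nat_diff)
  then show ?thesis
    using that[of "m - n"] False assms by (simp add: eqv_def)
qed

lemma positive_characteristic:
  assumes "t - 1 \<notin> I"
  obtains N :: nat where "0 < N" "of_nat N \<in> I"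
proof -
  obtain d :: nat and f where d: "0 < d" "of_nat d \<approx> (t - 1) * f"
    using of_nat_multiple[OF assms] .
  \<comment> \<open>Modulo \<open>I\<close> both lie in 1 plus multiples of \<open>t - 1\<close>,
    and \<open>2 * P - Q = 1\<close> makes them coprime.\<close>
  define P Q where "P = 1 + d" and "Q = 1 + 2 * d"
  have PQ: "P > 1" "Q > 1"
    using d by (auto simp: P_def Q_def)
  have "coprime P Q"
  proof (rule coprimeI)
    fix c assume "c dvd P" "c dvd Q"
    then have "c dvd 2 * P - Q"
      by (simp add: dvd_diff_nat)
    then show "is_unit c"
      by (simp add: P_def Q_def)
  qed
  have *: "\<exists>n. of_nat (1 + k * d) \<approx> t ^ n \<or> t ^ n * of_nat (1 + k * d) \<approx> 1" for k
  proof -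
    have "of_nat (1 + k * d) \<approx> 1 + of_nat k * ((t - 1) * f)"
      using d(2) by (auto intro: eqv_add eqv_mult eqv_refl)
    then have k: "of_nat (1 + k * d) \<approx> 1 + (t - 1) * (of_nat k * f)"
      by (simp add: algebra_simps)
    show ?thesis
      using one_plus_multiple[of "of_nat k * f"] k eqv_trans eqv_mult[OF eqv_refl k]
      by meson
  qed
  obtain a where a: "of_nat P \<approx> t ^ a \<or> t ^ a * of_nat P \<approx> 1"
    using *[of 1] by (auto simp: P_def)
  obtain b where b: "of_nat Q \<approx> t ^ b \<or> t ^ b * of_nat Q \<approx> 1"
    using *[of 2] by (auto simp: Q_def)
  show thesis
  \<comment> \<open>A zero exponent already makes \<open>P\<close> or \<open>Q\<close>, both larger
    than 1, congruent to 1.\<close>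
  proof (cases "a = 0 \<or> b = 0")
    case True
    then have "of_nat P \<approx> of_nat 1 \<or> of_nat Q \<approx> of_nat 1"
      using a b by auto
    then show thesis
      using of_nat_eqv_imp_char that PQ by (metis less_irrefl)
  next
    case False
    then have neq: "P ^ b \<noteq> Q ^ a"
      using coprime_powers_neq[OF \<open>coprime P Q\<close>] PQ by simp
    have "P ^ b * Q ^ a > 1"
      using PQ False by (metis less_1_mult one_less_power gr0I)
    then have neq': "P ^ b * Q ^ a \<noteq> 1"
      by linarith
    have inv: "t ^ (m * n) * of_nat (R ^ n) \<approx> 1" if "t ^ m * of_nat R \<approx> 1" for m n R
      using eqv_power[OF that, of n] by (simp add: power_mult_distrib power_mult)
    have pow: "of_nat (R ^ n) \<approx> t ^ (m * n)" if "of_nat R \<approx> t ^ m" for m n R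
      using eqv_power[OF that, of n] by (simp add: power_mult)
    consider "of_nat P \<approx> t ^ a" "of_nat Q \<approx> t ^ b"
      | "t ^ a * of_nat P \<approx> 1" "t ^ b * of_nat Q \<approx> 1"
      | "of_nat P \<approx> t ^ a" "t ^ b * of_nat Q \<approx> 1"
      | "t ^ a * of_nat P \<approx> 1" "of_nat Q \<approx> t ^ b"
      using a b by blast
    \<comment> \<open>Raising to the powers \<open>b\<close> and \<open>a\<close> brings both
      exponents of \<open>t\<close> to \<open>a * b\<close> up to sign. Equal signs equate the two
      integers; opposite signs make their product congruent to 1.\<close>
    then have "of_nat (P ^ b) \<approx> of_nat (Q ^ a) \<or> of_nat (P ^ b * Q ^ a) \<approx> of_nat 1"
    proof cases
      case 1
      then show ?thesis
        using pow[OF 1(1), of b] pow[OF 1(2), of a] eqv_sym eqv_trans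
        by (metis mult.commute)
    next
      case 2
      then show ?thesis
        using inv[OF 2(1), of b] inv[OF 2(2), of a] eqv_sym eqv_trans eqv_cancel_power
        by (metis mult.commute)
    next
      case 3
      have "of_nat (P ^ b) * of_nat (Q ^ a) \<approx> t ^ (a * b) * of_nat (Q ^ a)"
        using pow[OF 3(1), of b] eqv_mult eqv_refl by blast
      also have "\<dots> \<approx> 1"
        using inv[OF 3(2), of a] by (simp add: mult.commute)
      finally show ?thesis
        by simp
    next
      case 4
      have "of_nat (Q ^ a) * of_nat (P ^ b) \<approx> t ^ (b * a) * of_nat (P ^ b)"
        using pow[OF 4(2), of a] eqv_mult eqv_refl by blast
      also have "\<dots> \<approx> 1"
        using inv[OF 4(1), of b] by (simp add: mult.commute)
      finally show ?thesis
        by (simp add: mult.commute)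
    qed
    then show thesis
      using of_nat_eqv_imp_char that neq neq' by metis
  qed
qed

section \<open>Finite order of \<open>t\<close>\<close>

lemma monic_relation:
  assumes "t - 1 \<notin> I"
  obtains D :: nat and c :: "nat \<Rightarrow> int"
  where "0 < D" "t ^ D \<approx> (\<Sum>i<D. of_int (c i) * t ^ i)"
proof -
  obtain n where "t - (\<Sum>i<n. t ^ i) \<in> I \<or> t ^ n * t + (\<Sum>i<n. t ^ i) \<in> I"
    using geometric_rep by blast
  then show thesis
  proof
    assume n: "t - (\<Sum>i<n. t ^ i) \<in> I"
    have "t \<notin> I"
      using cancel[of 1] one_notin by auto
    \<comment> \<open>Lengths 0, 1 and 2 would put \<open>t\<close>, \<open>t - 1\<close> or
      \<open>- 1\<close> into \<open>I\<close>. From length 3 on, the top power exceeds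
      \<open>t\<close> itself and can be isolated; the coefficient of \<open>t\<close> is then 1 - 1
      = 0.\<close>
    then have "n \<noteq> 0"
      using n by (intro notI) simp
    moreover have "n \<noteq> 1"
      using n assms by (intro notI) simp
    moreover have "n \<noteq> 2"
      using n one_notin uminus_mem[of "- 1"] by (auto simp: numeral_2_eq_2)
    ultimately obtain m where m: "n = Suc m" "m > 1"
      by (cases n) auto
    have "(\<Sum>i<m. of_int (if i = 1 then 0 else - 1) * t ^ i)
        = (\<Sum>i<m. (if i = 1 then t else 0) - t ^ i)"
      by (rule sum.cong) auto
    also have "\<dots> = t - (\<Sum>i<m. t ^ i)"
      using m(2) by (simp add: sum_subtractf)
    finally have "t ^ m \<approx> (\<Sum>i<m. of_int (if i = 1 then 0 else - 1) * t ^ i)"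
      using uminus_mem[OF n] by (simp only: eqv_def m(1)) (simp add: algebra_simps)
    then show thesis
      using m(2) by (intro that[of m "\<lambda>i. if i = 1 then 0 else - 1"]) linarith
  next
    assume n: "t ^ n * t + (\<Sum>i<n. t ^ i) \<in> I"
    \<comment> \<open>The relation has degree \<open>Suc n\<close>, so the missing term
      \<open>t ^ n\<close> is padded with coefficient 0.\<close>
    have "(\<Sum>i<Suc n. of_int (if i < n then - 1 else 0) * t ^ i) = - (\<Sum>i<n. t ^ i)"
      by (simp add: sum_negf)
    then have "t ^ Suc n \<approx> (\<Sum>i<Suc n. of_int (if i < n then - 1 else 0) * t ^ i)"
      using n by (simp only: eqv_def) (simp add: mult.commute)
    then show thesis
      by (rule that[OF zero_less_Suc])
  qed
qed

lemma finite_order: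
  assumes "t - 1 \<notin> I" and N: "0 < N" "of_nat N \<in> I"
  obtains r :: nat where "0 < r" "t ^ r \<approx> 1"
proof -
  obtain D c where D: "0 < D" and rel: "t ^ D \<approx> (\<Sum>i<D. of_int (c i) * t ^ i)"
    using monic_relation[OF assms(1)] by metis
  define F where "F = (\<Pi>\<^sub>E i\<in>{..<D}. {0..<int N})"
  define ev where "ev e = (\<Sum>i<D. of_int (e i) * t ^ i)" for e :: "nat \<Rightarrow> int"
  have "finite F"
    unfolding F_def by (intro finite_PiE) auto
  have reduce: "\<exists>e'\<in>F. ev e \<approx> ev e'" for e
  proof (intro bexI)
    show "restrict (\<lambda>i. e i mod int N) {..<D} \<in> F"
      using N(1) by (auto simp: F_def)
    have "of_int k \<approx> of_int (k mod int N)" for k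
    proof -
      have "of_int k - of_int (k mod int N) = (of_int (k - k mod int N) :: 'r)"
        by simp
      also have "\<dots> = of_int (k div int N) * of_nat N"
        by (metis minus_mod_eq_div_mult of_int_mult of_int_of_nat_eq)
      finally show ?thesis
        using N(2) mult_mem by (simp add: eqv_def)
    qed
    then show "ev e \<approx> ev (restrict (\<lambda>i. e i mod int N) {..<D})"
      unfolding ev_def by (auto intro!: eqv_sum eqv_mult eqv_refl)
  qed
  \<comment> \<open>The coefficients move up one place, and the overflowing \<open>t ^ D\<close> is
    rewritten by the monic relation.\<close>
  have shift: "\<exists>e'. t * ev e \<approx> ev e'" for e
  proof -
    obtain m where m: "D = Suc m"
      using D by (cases D) auto
    have "t * ev e = (\<Sum>i<m. of_int (e i) * t ^ Suc i) + of_int (e m) * t ^ D"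
      by (simp add: ev_def m sum_distrib_left algebra_simps)
    also have "\<dots> \<approx> (\<Sum>i<m. of_int (e i) * t ^ Suc i) + of_int (e m) * (\<Sum>i<D. of_int (c i) * t ^ i)"
      by (intro eqv_add eqv_mult eqv_refl rel)
    also have "(\<Sum>i<m. of_int (e i) * t ^ Suc i)
        = (\<Sum>i<D. of_int (case i of 0 \<Rightarrow> 0 | Suc j \<Rightarrow> e j) * t ^ i)"
      unfolding m by (subst sum.lessThan_Suc_shift) simp
    also have "\<dots> + of_int (e m) * (\<Sum>i<D. of_int (c i) * t ^ i)
        = ev (\<lambda>i. (case i of 0 \<Rightarrow> 0 | Suc j \<Rightarrow> e j) + e m * c i)"
      by (simp add: ev_def sum_distrib_left sum.distrib algebra_simps)
    finally show ?thesis
      by blast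
  qed
  have "\<exists>e. t ^ k \<approx> ev e" for k
  proof (induction k)
    case 0
    have "ev (\<lambda>i. if i = 0 then 1 else 0) = (\<Sum>i<D. if i = 0 then 1 else 0)"
      unfolding ev_def by (rule sum.cong) auto
    also have "\<dots> = 1"
      using D by simp
    finally show ?case
      using eqv_refl by (metis power_0)
  next
    case (Suc k)
    then obtain e where "t ^ k \<approx> ev e"
      by blast
    then have "t ^ Suc k \<approx> t * ev e"
      using eqv_mult[OF eqv_refl[of t]] by simp
    then show ?case
      using shift eqv_trans by blast
  qed
  then have "\<forall>k. \<exists>e\<in>F. t ^ k \<approx> ev e"
    using reduce eqv_trans by blast
  then obtain e where e: "\<And>k. e k \<in> F" "\<And>k. t ^ k \<approx> ev (e k)"
    by metis
  have "\<not> inj e"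
    using \<open>finite F\<close> e(1) finite_subset[of "range e" F] finite_imageD[of e UNIV] by auto
  then obtain i j where ij: "i < j" "e i = e j"
    unfolding inj_def by (metis linorder_neqE_nat)
  then have "t ^ j \<approx> t ^ i"
    using e(2) eqv_sym eqv_trans by metis
  then have "t ^ i * t ^ (j - i) \<approx> t ^ i * 1"
    using ij(1) by (simp flip: power_add)
  then show thesis
    using that[of "j - i"] ij(1) eqv_cancel_power by simp
qed

lemma minus_one_mem: "t - 1 \<in> I"
proof (rule ccontr)
  assume s: "t - 1 \<notin> I"
  obtain N :: nat where N: "0 < N" "of_nat N \<in> I"
    using positive_characteristic[OF s] .
  obtain r where r: "0 < r" "t ^ r \<approx> 1"
    using finite_order[OF s N] .
  \<comment> \<open>Since \<open>t ^ r\<close> is congruent to 1, all blocks of \<open>r\<close>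
    consecutive powers have congruent sums.\<close>
  have "(\<Sum>i<k * r. t ^ i) \<approx> of_nat k * (\<Sum>i<r. t ^ i)" for k
  proof (induction k)
    case (Suc k)
    have "(\<Sum>i<Suc k * r. t ^ i) = (\<Sum>i<k * r. t ^ i) + (\<Sum>i<r. t ^ (k * r + i))"
      using sum.nat_group[of "\<lambda>i. t ^ i" r "Suc k"] sum.nat_group[of "\<lambda>i. t ^ i" r k]
      by (simp add: sum.atLeastLessThan_shift_0 atLeast0LessThan add.commute)
    also have "\<dots> = (\<Sum>i<k * r. t ^ i) + (t ^ r) ^ k * (\<Sum>i<r. t ^ i)"
      by (simp add: power_add sum_distrib_left flip: power_mult)
         (simp add: mult.commute)
    also have "\<dots> \<approx> of_nat k * (\<Sum>i<r. t ^ i) + 1 ^ k * (\<Sum>i<r. t ^ i)"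
      by (intro eqv_add eqv_mult eqv_refl eqv_power Suc r)
    finally show ?case
      by (simp add: algebra_simps)
  qed (simp add: eqv_refl)
  then have "(\<Sum>i<N * r. t ^ i) \<approx> of_nat N * (\<Sum>i<r. t ^ i)" .
  moreover have "of_nat N * (\<Sum>i<r. t ^ i) \<approx> 0"
    using N(2) mult_mem[of "of_nat N" "\<Sum>i<r. t ^ i"] by (simp add: eqv_def mult.commute)
  ultimately have "(\<Sum>i<N * r. t ^ i) \<in> I"
    using eqv_trans unfolding eqv_def by (metis diff_zero)
  then show False
    using geometric_nonzero[of "N * r"] N r by simp
qed

end

section \<open>The lambda action of a left brace\<close>

context left_brace
begin

sublocale abelian_group A
  using additive_comm_group
  by (simp add: abelian_group_def abelian_group_axioms_def abelian_monoid_def comm_group_def)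

sublocale mult: group A
  by (rule multiplicative_group)

text \<open>The standard lambda map: the multiplicative group acts through it on the additive group
  by automorphisms.\<close>

definition lam :: "'a \<Rightarrow> 'a \<Rightarrow> 'a"
  where "lam a b = \<ominus> a \<oplus> a \<otimes> b"

lemma lam_closed [simp, intro]: "\<lbrakk>a \<in> carrier A; b \<in> carrier A\<rbrakk> \<Longrightarrow> lam a b \<in> carrier A"
  by (simp add: lam_def)

lemma mult_eq: "\<lbrakk>a \<in> carrier A; b \<in> carrier A\<rbrakk> \<Longrightarrow> a \<otimes> b = a \<oplus> lam a b"
  by (simp add: lam_def r_neg1 a_assoc[symmetric] r_neg)

lemma lam_add:
  "\<lbrakk>a \<in> carrier A; b \<in> carrier A; c \<in> carrier A\<rbrakk> \<Longrightarrow> lam a (b \<oplus> c) = lam a b \<oplus> lam a c"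
  by (simp add: lam_def brace_law a_minus_def a_ac)

lemma lam_zero [simp]: "a \<in> carrier A \<Longrightarrow> lam a \<zero> = \<zero>"
  using lam_add[of a \<zero> \<zero>] add.r_cancel_one'[of "lam a \<zero>" "lam a \<zero>"] by simp

lemma zero_eq_one: "\<zero> = \<one>"
  using mult_eq[of \<one> \<zero>] by simp

lemma lam_neg: "\<lbrakk>a \<in> carrier A; b \<in> carrier A\<rbrakk> \<Longrightarrow> lam a (\<ominus> b) = \<ominus> lam a b"
  using lam_add[of a "\<ominus> b" b] by (simp add: l_neg minus_equality)

text \<open>Both sides come from expanding \<open>a \<otimes> (b \<otimes> c)\<close> and cancelling
  \<open>a \<otimes> b\<close> additively.\<close>

lemma lam_mult:
  assumes "a \<in> carrier A" "b \<in> carrier A" "c \<in> carrier A"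
  shows "lam (a \<otimes> b) c = lam a (lam b c)"
proof -
  have "(a \<otimes> b) \<oplus> lam (a \<otimes> b) c = a \<otimes> (b \<otimes> c)"
    using assms by (simp add: mult_eq[symmetric] mult.m_assoc)
  also have "\<dots> = a \<oplus> lam a (b \<oplus> lam b c)"
    using assms by (simp add: mult_eq)
  also have "\<dots> = (a \<otimes> b) \<oplus> lam a (lam b c)"
    using assms by (simp add: lam_add mult_eq a_assoc)
  finally show ?thesis
    using assms by simp
qed

lemma lam_one: "b \<in> carrier A \<Longrightarrow> lam \<one> b = b"
  using mult_eq[of \<one> b] by (metis l_zero lam_closed mult.l_one mult.one_closed zero_eq_one)

lemma lam_inv:
  assumes "a \<in> carrier A" "b \<in> carrier A"
  shows "lam (inv a) (lam a b) = b"
  using lam_mult[of "inv a" a b] assms by (simp add: lam_one)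

end

section \<open>The additive group as a cyclic module\<close>

locale infinite_cyclic_brace = left_brace +
  fixes h :: "int \<Rightarrow> 'a"
  assumes h_hom: "h (m + n) = h m \<otimes> h n"
    and h_bij: "bij_betw h UNIV (carrier A)"
begin

definition T :: "'a \<Rightarrow> 'a"
  where "T = lam (h 1)"

text \<open>The additive group as a cyclic module over polynomials in \<open>T\<close>: this is \<open>p \<mapsto> p(T)(h 1)\<close>.\<close>

definition act :: "int poly \<Rightarrow> 'a"
  where "act p = fold_coeffs (\<lambda>a y. add_pow A a (h 1) \<oplus> T y) p \<zero>"

lemma h_closed [simp, intro]: "h n \<in> carrier A"
  using h_bij by (auto simp: bij_betw_def)

lemma h_zero: "h 0 = \<zero>"
  using h_hom[of 0 0] mult.l_cancel_one'[of "h 0" "h 0"] by (simp add: zero_eq_one)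

lemma T_closed [simp, intro]: "a \<in> carrier A \<Longrightarrow> T a \<in> carrier A"
  by (simp add: T_def)

lemma T_power_closed [simp, intro]: "a \<in> carrier A \<Longrightarrow> (T ^^ n) a \<in> carrier A"
  by (induction n) auto

lemma T_add: "\<lbrakk>a \<in> carrier A; b \<in> carrier A\<rbrakk> \<Longrightarrow> T (a \<oplus> b) = T a \<oplus> T b"
  by (simp add: T_def lam_add)

lemma T_zero [simp]: "T \<zero> = \<zero>"
  by (simp add: T_def)

lemma T_inj: "\<lbrakk>T a = T b; a \<in> carrier A; b \<in> carrier A\<rbrakk> \<Longrightarrow> a = b"
  unfolding T_def by (metis h_closed lam_inv)

lemma int_zero_multiple [simp]: "add_pow A (0::int) a = \<zero>"
  by (simp add: add_pow_def)

lemma act_0 [simp]: "act 0 = \<zero>"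
  by (simp add: act_def)

lemma act_pCons [simp]: "act (pCons a p) = add_pow A a (h 1) \<oplus> T (act p)"
proof (cases "p = 0 \<and> a = 0")
  case True
  then show ?thesis
    by (simp add: act_def)
next
  case False
  then show ?thesis
    unfolding act_def by (auto simp: fold_coeffs_pCons_coeff_not_0_eq fold_coeffs_pCons_not_0_0_eq)
qed

lemma act_closed [simp, intro]: "act p \<in> carrier A"
  by (induction p) auto

lemma act_add: "act (p + q) = act p \<oplus> act q"
proof (induction p q rule: poly_induct2)
  case (pCons a p b q)
  then show ?case
    by (simp add: T_add add.int_pow_mult a_ac)
qed simp

text \<open>Makes the kernel of \<open>act\<close> an ideal, although \<open>act\<close> is only
  additive. Peeling off coefficients of \<open>r\<close> leaves integer scalars and shifts, and a
  shift becomes \<open>T\<close>.\<close>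

lemma act_mult_zero:
  assumes "act p = \<zero>"
  shows "act (r * p) = \<zero>"
proof (induction r)
  case (pCons a r)
  have "act (smult a p) = \<zero>"
  proof -
    have "act (smult (int n) p) = \<zero>" for n
      using assms by (induction n) (simp_all add: smult_add_left act_add)
    moreover have "act (- q) = \<zero>" if "act q = \<zero>" for q
      using act_add[of q "- q"] that by simp
    ultimately show ?thesis
      by (cases a rule: int_cases2) (metis, metis smult_minus_left)
  qed
  then show ?case
    using pCons by (simp add: act_add)
qed simp

lemma monom_mult: "monom 1 1 * p = pCons 0 p" for p :: "int poly"
  by (simp add: monom_altdef)

lemma act_shift: "act (monom 1 1 ^ n * p) = (T ^^ n) (act p)"
  by (induction n) (simp_all add: mult.assoc monom_mult del: One_nat_def)

lemma h_Suc: "h (1 + n) = h 1 \<oplus> T (h n)"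
  by (simp add: h_hom T_def mult_eq)

text \<open>The Horner form of the sum follows the recursion \<open>h_Suc\<close>.\<close>

lemma act_geometric: "act (\<Sum>i<n. monom 1 1 ^ i) = h (int n)"
proof (induction n)
  case (Suc n)
  have "(\<Sum>i<Suc n. monom 1 1 ^ i) = pCons 1 (\<Sum>i<n. monom 1 1 ^ i :: int poly)"
  proof -
    have "(\<Sum>i<Suc n. monom 1 1 ^ i) = 1 + monom 1 1 * (\<Sum>i<n. monom 1 1 ^ i :: int poly)"
      by (subst sum.lessThan_Suc_shift) (simp add: sum_distrib_left)
    also have "\<dots> = [:1:] + pCons 0 (\<Sum>i<n. monom 1 1 ^ i)"
      by (simp only: monom_mult pCons_one)
    finally show ?thesis
      by simp
  qed
  then show ?case
    using h_Suc[of "int n"] Suc by simp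
qed (simp add: h_zero)

lemma lam_power: "a \<in> carrier A \<Longrightarrow> lam (h (int n)) a = (T ^^ n) a"
proof (induction n)
  case 0
  then show ?case
    using lam_one h_zero zero_eq_one by simp
next
  case (Suc n)
  have "h (int (Suc n)) = h 1 \<otimes> h (int n)"
    by (simp flip: h_hom)
  then show ?case
    using Suc by (simp add: lam_mult T_def)
qed

lemma T_power_h_neg: "h (int n) \<oplus> (T ^^ n) (h (- int n)) = \<zero>"
  using h_hom[of "int n" "- int n"] by (simp add: h_zero mult_eq lam_power)

text \<open>Injectivity of \<open>T\<close> gives cancellation, injectivity of \<open>h\<close> the
  nonvanishing of positive sums. Surjectivity of \<open>h\<close> gives the representation, where
  the sign of the exponent selects the alternative.\<close>

lemma geometric_ideal_act: "geometric_ideal {p. act p = \<zero>} (monom 1 1)"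
proof
  fix p q r :: "int poly"
  show "0 \<in> {p. act p = \<zero>}"
    by simp
  show "p + q \<in> {p. act p = \<zero>}" if "p \<in> {p. act p = \<zero>}" "q \<in> {p. act p = \<zero>}"
    using that by (simp add: act_add)
  show "r * p \<in> {p. act p = \<zero>}" if "p \<in> {p. act p = \<zero>}"
    using that by (simp add: act_mult_zero)
  show "p \<in> {p. act p = \<zero>}" if "monom 1 1 * p \<in> {p. act p = \<zero>}"
    using that T_inj[of "act p" \<zero>] by (simp add: monom_mult del: One_nat_def)
  show "(\<Sum>i<n. monom 1 1 ^ i) \<notin> {p. act p = \<zero>}" if "0 < n" for n
  proof -
    have "h (int n) \<noteq> h 0"
      using that h_bij by (auto simp: bij_betw_def dest: injD)
    then show ?thesis
      by (simp only: act_geometric mem_Collect_eq h_zero not_False_eq_True)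
  qed
  obtain k where k: "act p = h k"
    using h_bij act_closed[of p] unfolding bij_betw_def by blast
  show "\<exists>n. p - (\<Sum>i<n. monom 1 1 ^ i) \<in> {p. act p = \<zero>}
      \<or> monom 1 1 ^ n * p + (\<Sum>i<n. monom 1 1 ^ i) \<in> {p. act p = \<zero>}"
  proof (cases k rule: int_cases2)
    case (nonneg n)
    have "act (p - (\<Sum>i<n. monom 1 1 ^ i)) \<oplus> h (int n) = h (int n)"
      using act_add[of "p - (\<Sum>i<n. monom 1 1 ^ i)" "\<Sum>i<n. monom 1 1 ^ i"] k nonneg
      by (simp add: act_geometric del: One_nat_def)
    then have "act (p - (\<Sum>i<n. monom 1 1 ^ i)) = \<zero>"
      by simp
    then show ?thesis
      by blast
  next
    case (nonpos n)
    have "act (monom 1 1 ^ n * p + (\<Sum>i<n. monom 1 1 ^ i)) = \<zero>"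
      using T_power_h_neg[of n] k nonpos
      by (simp add: act_add act_shift act_geometric a_comm del: One_nat_def)
    then show ?thesis
      by blast
  qed
qed

section \<open>Triviality of the action\<close>

lemma T_generator: "T (h 1) = h 1"
proof -
  have "act (monom 1 1 - 1) = \<zero>"
    using geometric_ideal.minus_one_mem[OF geometric_ideal_act] by simp
  then have "act (monom 1 1) = act 1"
    using act_add[of "monom 1 1 - 1" 1] by simp
  then show ?thesis
    using act_geometric[of 1] by (simp add: monom_altdef)
qed

lemma T_power_generator: "(T ^^ n) (h 1) = h 1"
  by (induction n) (simp_all add: T_generator)

text \<open>Splitting off \<open>h 1\<close> on the left or on the right of \<open>h (1 + n)\<close>
  gives two sums to compare.\<close>

lemma T_h_nonneg: "T (h (int n)) = h (int n)"
proof -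
  have "h 1 \<oplus> T (h (int n)) = h (int n) \<otimes> h 1"
    using h_Suc[of "int n"] by (simp add: add.commute flip: h_hom)
  also have "\<dots> = h 1 \<oplus> h (int n)"
    by (simp add: mult_eq lam_power T_power_generator a_comm)
  finally show ?thesis
    by simp
qed

lemma T_id:
  assumes "a \<in> carrier A"
  shows "T a = a"
proof -
  obtain k where k: "a = h k"
    using h_bij assms unfolding bij_betw_def by blast
  show ?thesis
  proof (cases k rule: int_cases2)
    case (nonneg n)
    then show ?thesis
      using k T_h_nonneg by simp
  next
    case (nonpos n)
    have eq: "lam (h (int n)) a = \<ominus> h (int n)"
      using T_power_h_neg[of n] k nonpos assms
      by (metis add.inv_equality a_comm h_closed lam_closed lam_power)
    \<comment> \<open>\<open>T\<close> commutes with its own powers and fixes the negative of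
      \<open>h (int n)\<close>; invertibility of \<open>lam (h (int n))\<close> then carries this
      back to \<open>a\<close>.\<close>
    have "lam (h (int n)) (T a) = T (lam (h (int n)) a)"
      using assms by (simp add: lam_power funpow_swap1)
    also have "\<dots> = lam (h (int n)) a"
      unfolding eq using T_h_nonneg[of n] by (simp add: T_def lam_neg)
    finally show ?thesis
      using assms by (metis T_closed h_closed lam_inv)
  qed
qed

lemma lam_id:
  assumes "a \<in> carrier A" "b \<in> carrier A"
  shows "lam a b = b"
proof -
  have lam_nonneg: "lam (h (int n)) c = c" if "c \<in> carrier A" for n c
    using that by (simp add: lam_power) (induction n; simp add: T_id)
  obtain k where k: "a = h k"
    using h_bij assms unfolding bij_betw_def by blast
  show ?thesis
  proof (cases k rule: int_cases2)
    case (nonneg n)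
    then show ?thesis
      using k assms lam_nonneg by simp
  next
    case (nonpos n)
    \<comment> \<open>The multiplicative inverse \<open>h (int n)\<close> of \<open>a\<close> acts
      trivially, so it may be inserted.\<close>
    have "lam a b = lam a (lam (h (int n)) b)"
      using assms lam_nonneg by simp
    also have "\<dots> = lam (a \<otimes> h (int n)) b"
      using assms by (simp add: lam_mult)
    also have "a \<otimes> h (int n) = \<one>"
      using k nonpos h_zero zero_eq_one by (simp flip: h_hom)
    finally show ?thesis
      using assms by (simp add: lam_one)
  qed
qed

lemma mult_eq_add: "\<lbrakk>a \<in> carrier A; b \<in> carrier A\<rbrakk> \<Longrightarrow> a \<otimes> b = a \<oplus> b"
  by (simp add: mult_eq lam_id)

end

theorem theorem5p5:
  fixes A :: "('a, 'm) ring_scheme" (structure)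
  assumes "left_brace A"
    and "A \<cong> integer_group"
  shows "(\<forall>a \<in> carrier A. \<forall>b \<in> carrier A. a \<otimes> b = a \<oplus> b)
    \<and> add_monoid A \<cong> integer_group"
proof -
  interpret left_brace A
    by (rule assms(1))
  have "integer_group \<cong> A"
    by (rule mult.iso_sym[OF assms(2)])
  then obtain h where h: "h \<in> iso integer_group A"
    unfolding is_iso_def by blast
  interpret infinite_cyclic_brace A h
    by unfold_locales (use h in \<open>auto simp: iso_def hom_def\<close>)
  have "id \<in> iso (add_monoid A) A"
    by (auto simp: iso_def hom_def mult_eq_add)
  then have "add_monoid A \<cong> A"
    unfolding is_iso_def by blast
  then have "add_monoid A \<cong> integer_group"
    using assms(2) iso_trans by blast
  then show ?thesis
    using mult_eq_add by blast
qed

end
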